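(* Let $\vec\mu=\mu_1\times\mu_2$ and $\vec\nu=\nu_1\times\nu_2$ be positive measures on the space $X\times X$ and, for $i\in\{1,2\}$, let $K_i$ be a nonnegative function on $X\times X$. Let $T$ be the integral operator defined by, for any $(x,y)\in X\times X$, $$Tf(x,y):=\int_X\int_X K_1(x,s)K_2(y,t)f(s,t)\,d\mu_1(s)\,d\mu_2(t).$$ Suppose $\vec p=(1,p_2)$ with $p_2\in(1,\infty)$ and $\vec q=(q_1,q_2)\in(1,\infty)^2$ satisfy $1<p_2\le q_-<\infty$, where $q_-:=\min\{q_1,q_2\}$. Let $\gamma_i,\delta_i$ be real numbers with $\gamma_i+\delta_i=1$ for $i\in\{1,2\}$. If there exist two positive functions $h_1,h_2$ on $X\times X$ and two positive constants $C_1,C_2$ such that for almost all $(x,y)\in X\times X$, $$\int_X\Big[\operatorname*{ess\,sup}_{s\in X}[K_1(x,s)]^{\gamma_1}[K_2(y,t)]^{\gamma_2}h_1(s,t)\Big]^{p_2'}d\mu_2(t)\le C_1[h_2(x,y)]^{p_2'}$$ and for almost all $(s,t)\in X\times X$, $$\int_X\Big[\int_X [K_1(x,s)]^{\delta_1q_1}[K_2(y,t)]^{\delta_2q_1}[h_2(x,y)]^{q_1}\,d\nu_1(x)\Big]^{q_2/q_1}d\nu_2(y)\le C_2[h_1(s,t)]^{q_2},$$ then $T:L^{\vec p}_{\vec\mu}\to L^{\vec q}_{\vec\nu}$ is bounded with $\|T\|_{L^{\vec p}_{\vec\mu}\to L^{\vec q}_{\vec\nu}}\le C_1^{1/p_2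'}C_2^{1/q_2}$.
   Context: For $q\in[1,\infty]$, $q'$ is the Hölder conjugate exponent, $1/q+1/q'=1$. For $\vec p=(p_1,p_2)\in[1,\infty)^2$ and a product measure $\vec\mu=\mu_1\times\mu_2$ on $X\times X$, $L^{\vec p}_{\vec\mu}$ is the mixed-norm Lebesgue space of measurable $f$ on $X\times X$ with $$\|f\|_{L^{\vec p}_{\vec\mu}}=\Big\{\int_X\Big[\int_X|f(s,t)|^{p_1}\,d\mu_1(s)\Big]^{p_2/p_1}d\mu_2(t)\Big\}^{1/p_2}<\infty.$$ *)

theory Defs
  imports "HOL-Probability.Probability"
begin

(* Power of an extended nonnegative number with real exponent.  Unlike powr on the reals, for
   which 0 powr a = 0 for every a, this follows the usual measure-theoretic conventions
     x^0 = 1,   0^a = \<infinity> and \<infinity>^a = 0 for a < 0,   0^a = 0 and \<infinity>^a = \<infinity> for a > 0.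
   Products of such powers use the ennreal convention 0 * \<infinity> = 0. *)
definition ennpow :: "ennreal \<Rightarrow> real \<Rightarrow> ennreal" (infixr "^\<^sub>e" 80) where
  "x ^\<^sub>e a =
     (if a = 0 then 1
      else if a > 0 then (if x = \<infinity> then \<infinity> else ennreal (enn2real x powr a))
      else inverse (if x = \<infinity> then \<infinity> else ennreal (enn2real x powr (- a))))"

(* Inner integral over the first variable with exponent p1 with respect to the first measure,
   outer integral over the second variable with exponent p2. *)
fun mixed_norm ::
  "real \<times> real \<Rightarrow> 'a measure \<times> 'b measure \<Rightarrow> ('a \<times> 'b \<Rightarrow> 'c::real_normed_vector) \<Rightarrow> ennreal" where
  "mixed_norm (p1, p2) (M1, M2) f =
     (\<integral>\<^sup>+ t. (\<integral>\<^sup>+ s. ennreal (norm (f (s, t))) ^\<^sub>e p1 \<partial>M1) ^\<^sub>e (p2 / p1) \<partial>M2) ^\<^sub>e (1 / p2)"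

(* Functions, not classes of functions modulo equality almost everywhere. *)
fun mixed_Lp ::
  "real \<times> real \<Rightarrow> 'a measure \<times> 'b measure \<Rightarrow> ('a \<times> 'b \<Rightarrow> 'c::real_normed_vector) set" where
  "mixed_Lp p (M1, M2) =
     {f. f \<in> borel_measurable (M1 \<Otimes>\<^sub>M M2) \<and> mixed_norm p (M1, M2) f < \<infinity>}"

definition mixed_op_norm ::
  "real \<times> real \<Rightarrow> 'a measure \<times> 'b measure \<Rightarrow> real \<times> real \<Rightarrow> 'c measure \<times> 'd measure \<Rightarrow>
   (('a \<times> 'b \<Rightarrow> 'e::real_normed_vector) \<Rightarrow> ('c \<times> 'd \<Rightarrow> 'e)) \<Rightarrow> ennreal" where
  "mixed_op_norm p \<mu> q \<nu> T =
     (SUP f \<in> {f \<in> mixed_Lp p \<mu>. mixed_norm p \<mu> f \<le> 1}. mixed_norm q \<nu> (T f))"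

(* T induces a bounded linear operator between the spaces of classes modulo equality almost
   everywhere: it maps L^p into L^q, respects almost everywhere equality, is linear up to null
   sets, and satisfies a norm estimate with a finite constant. *)
fun mixed_bounded_operator ::
  "real \<times> real \<Rightarrow> 'a measure \<times> 'b measure \<Rightarrow> real \<times> real \<Rightarrow> 'c measure \<times> 'd measure \<Rightarrow>
   (('a \<times> 'b \<Rightarrow> 'e::real_normed_field) \<Rightarrow> ('c \<times> 'd \<Rightarrow> 'e)) \<Rightarrow> bool" where
  "mixed_bounded_operator p (M1, M2) q (N1, N2) T \<longleftrightarrow>
     (\<forall>f \<in> mixed_Lp p (M1, M2). T f \<in> mixed_Lp q (N1, N2)) \<and>
     (\<forall>f \<in> mixed_Lp p (M1, M2). \<forall>g \<in> mixed_Lp p (M1, M2).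
        (AE z in M1 \<Otimes>\<^sub>M M2. f z = g z) \<longrightarrow> (AE z in N1 \<Otimes>\<^sub>M N2. T f z = T g z)) \<and>
     (\<forall>f \<in> mixed_Lp p (M1, M2). \<forall>g \<in> mixed_Lp p (M1, M2). \<forall>a b.
        AE z in N1 \<Otimes>\<^sub>M N2. T (\<lambda>w. a * f w + b * g w) z = a * T f z + b * T g z) \<and>
     (\<exists>C::real. 0 \<le> C \<and> (\<forall>f \<in> mixed_Lp p (M1, M2).
        mixed_norm q (N1, N2) (T f) \<le> ennreal C * mixed_norm p (M1, M2) f))"

end

theory Submission
  imports Defs
begin

text \<open>
  With \<open>K(z, w) = K1(x, s) K2(y, t)\<close> for \<open>z = (x, y)\<close> and \<open>w = (s, t)\<close>, and \<open>K^\<gamma>\<close>, \<open>K^\<delta>\<close>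
  the products of the corresponding powers, write \<open>K |f| = (K^\<gamma> h1) (K^\<delta> |f| / h1)\<close> and apply
  Hoelder's inequality in \<open>w\<close>: by the first hypothesis, \<open>|T f(z)|\<close> is at most \<open>C1^(1/p2')\<close> times
  the \<open>L^(1, p2)\<close> norm in \<open>w\<close> of \<open>K^\<delta> h2(z) |f| / h1\<close>. Since \<open>1 \<le> p2 \<le> min q1 q2\<close>, Minkowski's
  integral inequality allows taking the \<open>L^q\<close> norm in \<open>z\<close> first, and by the second hypothesis that
  norm is at most \<open>C2^(1/q2) |f|\<close>.
\<close>


section \<open>Real powers of extended nonnegative numbers\<close>

lemma ennpow_0 [simp]: "x ^\<^sub>e 0 = 1"
  by (simp add: ennpow_def)

lemma ennpow_1 [simp]: "x ^\<^sub>e 1 = x"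
  by (cases x rule: ennreal_cases) (auto simp: ennpow_def)

lemma ennpow_top: "0 < a \<Longrightarrow> \<top> ^\<^sub>e a = \<top>"
  by (simp add: ennpow_def)

lemma zero_ennpow: "0 < a \<Longrightarrow> 0 ^\<^sub>e a = 0"
  by (simp add: ennpow_def)

lemma ennpow_ennreal: "0 \<le> r \<Longrightarrow> 0 < a \<Longrightarrow> ennreal r ^\<^sub>e a = ennreal (r powr a)"
  by (simp add: ennpow_def)

lemma ennpow_ennreal_pos: "0 < r \<Longrightarrow> ennreal r ^\<^sub>e a = ennreal (r powr a)"
  by (auto simp: ennpow_def inverse_ennreal powr_minus)

lemma ennpow_mono: "0 < a \<Longrightarrow> x \<le> y \<Longrightarrow> x ^\<^sub>e a \<le> y ^\<^sub>e a"
  by (cases x rule: ennreal_cases; cases y rule: ennreal_cases)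
     (auto simp: ennpow_ennreal ennpow_top top_unique intro!: ennreal_leI powr_mono2)

text \<open>The inner exponent is left free because the kernels carry the exponents
  \<open>\<delta>1\<close>, \<open>\<delta>2\<close>, which may be negative. At the bases 0 and
  \<infinity> the sign of \<open>a\<close> decides; a positive real base reduces to
  \<open>powr_powr\<close>.\<close>

lemma ennpow_ennpow:
  assumes "0 < b"
  shows "(x ^\<^sub>e a) ^\<^sub>e b = x ^\<^sub>e (a * b)"
proof -
  consider "a = 0" | "x = 0" "0 < a" | "x = 0" "a < 0" | "x = \<top>" "0 < a" | "x = \<top>" "a < 0"
    | r where "x = ennreal r" "0 < r"
    by (cases x rule: ennreal_cases) (force simp: neq_iff less_eq_real_def)+
  then show ?thesis
  proof cases
    case 6
    then show ?thesis
      by (simp add: ennpow_ennreal_pos powr_powr)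
  qed (use assms in \<open>auto simp: ennpow_def zero_less_mult_iff mult_less_0_iff\<close>)
qed

text \<open>Positive powers respect the convention \<open>0 * \<top> = 0\<close>. Negative ones do
  not: \<open>(0 * \<top>) ^\<^sub>e a\<close> is then \<infinity>, while the product of the two
  powers is 0.\<close>

lemma ennpow_mult:
  assumes "0 < a"
  shows "(x * y) ^\<^sub>e a = x ^\<^sub>e a * y ^\<^sub>e a"
proof -
  have *: "(\<top> * y) ^\<^sub>e a = \<top> ^\<^sub>e a * y ^\<^sub>e a" for y
    by (cases y rule: ennreal_cases; cases "y = 0")
       (use assms in \<open>auto simp: ennpow_top zero_ennpow ennpow_ennreal ennreal_top_mult\<close>)
  show ?thesis
    using *[of x] *[of y] assms
    by (cases x rule: ennreal_cases; cases y rule: ennreal_cases)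
       (auto simp: ennpow_ennreal powr_mult mult.commute simp flip: ennreal_mult)
qed

lemma ennpow_add:
  assumes "0 < a" "0 < b"
  shows "x ^\<^sub>e (a + b) = x ^\<^sub>e a * x ^\<^sub>e b"
  by (cases x rule: ennreal_cases)
     (use assms in \<open>auto simp: ennpow_ennreal ennpow_top powr_add simp flip: ennreal_mult\<close>)

text \<open>For \<open>r > 0\<close> the exponents simply add up. At \<open>r = 0\<close> the left
  side is 0, so the bound survives exponents of either sign, as arbitrary real
  \<open>\<gamma>1\<close>, \<open>\<delta>1\<close> require.\<close>

lemma ennpow_mult_ennpow_le:
  assumes "0 \<le> r" "a + b = 1"
  shows "ennreal r \<le> ennreal r ^\<^sub>e a * ennreal r ^\<^sub>e b"
  by (cases "r = 0")
     (use assms in \<open>auto simp: ennpow_ennreal_pos simp flip: ennreal_mult powr_add\<close>)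

lemma ennpow_eq_0_iff: "0 < a \<Longrightarrow> x ^\<^sub>e a = 0 \<longleftrightarrow> x = 0"
  by (cases x rule: ennreal_cases) (auto simp: ennpow_ennreal ennpow_top)

lemma ennpow_eq_top_iff: "0 < a \<Longrightarrow> x ^\<^sub>e a = \<top> \<longleftrightarrow> x = \<top>"
  by (cases x rule: ennreal_cases) (auto simp: ennpow_ennreal ennpow_top)

lemma ennpow_less_top_iff: "0 < a \<Longrightarrow> x ^\<^sub>e a < \<top> \<longleftrightarrow> x < \<top>"
  by (simp add: less_top ennpow_eq_top_iff flip: less_top)

text \<open>The powers \<open>a\<close> and \<open>1 / a\<close> are monotone and inverse to each
  other, hence form a Galois connection.\<close>

lemma ennpow_inverse_le_iff: "0 < a \<Longrightarrow> x ^\<^sub>e (1 / a) \<le> y \<longleftrightarrow> x \<le> y ^\<^sub>e a"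
  using ennpow_mono[of a "x ^\<^sub>e (1 / a)" y] ennpow_mono[of "1 / a" x "y ^\<^sub>e a"]
  by (auto simp: ennpow_ennpow)

text \<open>An order isomorphism preserves suprema; the nontrivial half takes the root of the right
  side as an upper bound of all \<open>f i\<close>.\<close>

lemma ennpow_SUP:
  fixes f :: "nat \<Rightarrow> ennreal"
  assumes "0 < a"
  shows "(SUP i. f i) ^\<^sub>e a = (SUP i. f i ^\<^sub>e a)"
proof (rule antisym)
  have "f i \<le> (SUP i. f i ^\<^sub>e a) ^\<^sub>e (1 / a)" for i
    using ennpow_inverse_le_iff[of "1 / a" "f i", symmetric] assms
    by (simp add: SUP_upper[of i UNIV "\<lambda>i. f i ^\<^sub>e a"])
  then have "(SUP i. f i) \<le> (SUP i. f i ^\<^sub>e a) ^\<^sub>e (1 / a)"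
    by (rule SUP_least)
  then show "(SUP i. f i) ^\<^sub>e a \<le> (SUP i. f i ^\<^sub>e a)"
    using ennpow_inverse_le_iff[of "1 / a" "SUP i. f i"] assms by simp
qed (intro SUP_least ennpow_mono assms SUP_upper UNIV_I)

lemma borel_measurable_ennpow [measurable]:
  assumes [measurable]: "f \<in> borel_measurable M"
  shows "(\<lambda>x. f x ^\<^sub>e a) \<in> borel_measurable M"
  unfolding ennpow_def by measurable

section \<open>Hoelder's and Minkowski's inequalities for nonnegative integrals\<close>

text \<open>When both integrals on the right are positive and finite, Young's inequality is applied
  pointwise to the normalised functions and integrated. If one of them is 0, the product vanishes
  almost everywhere; if one is \<infinity> and the other nonzero, the right side is
  \<infinity>.\<close>

lemma nn_integral_Holder:
  fixes f g :: "'a \<Rightarrow> ennreal"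
  assumes p: "1 < p" "1 < q" "1 / p + 1 / q = 1"
    and [measurable]: "f \<in> borel_measurable M" "g \<in> borel_measurable M"
  shows "(\<integral>\<^sup>+ x. f x * g x \<partial>M) \<le> (\<integral>\<^sup>+ x. f x ^\<^sub>e p \<partial>M) ^\<^sub>e (1 / p) * (\<integral>\<^sup>+ x. g x ^\<^sub>e q \<partial>M) ^\<^sub>e (1 / q)"
proof -
  define A where "A = (\<integral>\<^sup>+ x. f x ^\<^sub>e p \<partial>M)"
  define B where "B = (\<integral>\<^sup>+ x. g x ^\<^sub>e q \<partial>M)"
  consider "A = 0" | "B = 0" | "A = \<top>" "B \<noteq> 0" | "B = \<top>" "A \<noteq> 0"
    | a b where "A = ennreal a" "B = ennreal b" "0 < a" "0 < b"
    by (cases A rule: ennreal_cases; cases B rule: ennreal_cases) (force simp: less_eq_real_def)+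
  then have "(\<integral>\<^sup>+ x. f x * g x \<partial>M) \<le> A ^\<^sub>e (1 / p) * B ^\<^sub>e (1 / q)"
  proof cases
    case 1
    then have "AE x in M. f x ^\<^sub>e p = 0"
      by (simp add: A_def nn_integral_0_iff_AE)
    then have "(\<integral>\<^sup>+ x. f x * g x \<partial>M) = 0"
      using p by (subst nn_integral_0_iff_AE) (auto simp: ennpow_eq_0_iff)
    then show ?thesis
      by simp
  next
    case 2
    then have "AE x in M. g x ^\<^sub>e q = 0"
      by (simp add: B_def nn_integral_0_iff_AE)
    then have "(\<integral>\<^sup>+ x. f x * g x \<partial>M) = 0"
      using p by (subst nn_integral_0_iff_AE) (auto simp: ennpow_eq_0_iff)
    then show ?thesis
      by simp
  next
    case 3
    then show ?thesis
      using p by (simp add: ennpow_top ennreal_top_mult ennpow_eq_0_iff)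
  next
    case 4
    then show ?thesis
      using p by (simp add: ennpow_top ennreal_mult_top ennpow_eq_0_iff)
  next
    case (5 a b)
    \<comment> \<open>\<open>c\<close> is the product of the two norms. Multiplying Young's
      inequality for the normalised values by \<open>c\<close> gives the coefficients
      \<open>c / (p * a)\<close> and \<open>c / (q * b)\<close>, which after integration sum to
      \<open>c * (1 / p + 1 / q) = c\<close>.\<close>
    define c where "c = a powr (1 / p) * b powr (1 / q)"
    have c: "0 < c" using 5 by (simp add: c_def)
    have young: "x * y \<le> ennreal (c / (p * a)) * x ^\<^sub>e p + ennreal (c / (q * b)) * y ^\<^sub>e q"
      for x y :: ennreal
    proof (cases "x = \<top> \<or> y = \<top>")
      case True
      then show ?thesis
        using p 5 c by (auto simp: ennpow_top ennreal_mult_top)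
    next
      case False
      then obtain u v where uv: "x = ennreal u" "y = ennreal v" "0 \<le> u" "0 \<le> v"
        by (cases x rule: ennreal_cases; cases y rule: ennreal_cases) auto
      have "u / a powr (1 / p) * (v / b powr (1 / q))
          \<le> (u / a powr (1 / p)) powr p / p + (v / b powr (1 / q)) powr q / q"
        by (rule Youngs_inequality) (use p uv in auto)
      also have "\<dots> = u powr p / (p * a) + v powr q / (q * b)"
        using p uv 5 by (simp add: powr_divide powr_powr mult.commute)
      finally have "u * v \<le> c * (u powr p / (p * a) + v powr q / (q * b))"
        using 5 c by (simp add: c_def pos_divide_le_eq mult.commute)
      then have "ennreal (u * v) \<le> ennreal (c / (p * a) * u powr p + c / (q * b) * v powr q)"
        by (intro ennreal_leI) (simp add: distrib_left)
      then show ?thesis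
        using uv p 5 c by (simp add: ennpow_ennreal flip: ennreal_mult ennreal_plus)
    qed
    have "(\<integral>\<^sup>+ x. f x * g x \<partial>M)
        \<le> (\<integral>\<^sup>+ x. ennreal (c / (p * a)) * f x ^\<^sub>e p + ennreal (c / (q * b)) * g x ^\<^sub>e q \<partial>M)"
      by (intro nn_integral_mono young)
    also have "\<dots> = ennreal (c / (p * a)) * A + ennreal (c / (q * b)) * B"
      unfolding A_def B_def by (simp add: nn_integral_add nn_integral_cmult)
    also have "\<dots> = ennreal (c / (p * a) * a + c / (q * b) * b)"
      using 5 c p by (simp flip: ennreal_mult)
    also have "c / (p * a) * a + c / (q * b) * b = c * (1 / p + 1 / q)"
      using 5 by (simp add: distrib_left)
    also have "ennreal (c * (1 / p + 1 / q)) = A ^\<^sub>e (1 / p) * B ^\<^sub>e (1 / q)"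
      using 5 p by (simp add: c_def ennpow_ennreal ennreal_mult)
    finally show ?thesis .
  qed
  then show ?thesis
    by (simp add: A_def B_def)
qed

text \<open>For \<open>r = 1\<close> this is Tonelli's theorem. For \<open>r > 1\<close>, write
  \<open>H\<close> for the inner integral and split \<open>H^r = H^(r-1) H\<close>; exchanging the
  integrals and applying Hoelder in \<open>x\<close> for each \<open>t\<close> bounds
  \<integral>\<open>H^r\<close> by its own power \<open>1 / r'\<close> times the right side, and
  that power is cancelled.\<close>

lemma nn_integral_Minkowski:
  fixes F :: "'a \<Rightarrow> 'b \<Rightarrow> ennreal"
  assumes "sigma_finite_measure M" "sigma_finite_measure N"
    and F[measurable]: "(\<lambda>(x, t). F x t) \<in> borel_measurable (M \<Otimes>\<^sub>M N)"
    and r: "1 \<le> r"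
  shows "(\<integral>\<^sup>+ x. (\<integral>\<^sup>+ t. F x t \<partial>N) ^\<^sub>e r \<partial>M) ^\<^sub>e (1 / r)
      \<le> (\<integral>\<^sup>+ t. (\<integral>\<^sup>+ x. F x t ^\<^sub>e r \<partial>M) ^\<^sub>e (1 / r) \<partial>N)" (is "_ \<le> ?R")
proof (cases "r = 1")
  interpret pair_sigma_finite M N
    using assms by (simp add: pair_sigma_finite_def)
  case True
  then show ?thesis
    using Fubini'[OF F] by simp
next
  interpret P: pair_sigma_finite M N
    using assms by (simp add: pair_sigma_finite_def)
  case False
  with r have r: "1 < r" by simp
  \<comment> \<open>The conjugate exponent of \<open>r\<close>: since
    \<open>(r - 1) * r' = r\<close>, the Hoelder factor coming from the power \<open>r - 1\<close>
    is again an integral of an \<open>r\<close>-th power.\<close>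
  define r' where "r' = r / (r - 1)"
  have r': "1 < r'" "1 / r' + 1 / r = 1" "(r - 1) * r' = r"
    using r by (auto simp: r'_def field_simps)
  obtain A :: "nat \<Rightarrow> 'a set" where A: "range A \<subseteq> sets M" "(\<Union>i. A i) = space M"
      "\<And>i. emeasure M (A i) \<noteq> \<infinity>" "incseq A"
    using P.M1.sigma_finite_incseq by metis
  have A_sets[measurable]: "A n \<in> sets M" for n
    using A(1) by auto
  define H where "H x = (\<integral>\<^sup>+ t. F x t \<partial>N)" for x
  have H[measurable]: "H \<in> borel_measurable M"
    unfolding H_def by measurable
  \<comment> \<open>The argument divides by a power of \<open>\<integral> H^r\<close>, which may be infinite; truncating \<open>H\<close> avoids this.\<close>
  define G where "G n x = min (H x) (of_nat n) * indicator (A n) x" for n x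
  have G[measurable]: "G n \<in> borel_measurable M" for n
    unfolding G_def by measurable
  have G_le: "G n x \<le> H x" for n x
    unfolding G_def by (auto simp: indicator_def)
  have bound: "(\<integral>\<^sup>+ x. G n x ^\<^sub>e r \<partial>M) ^\<^sub>e (1 / r) \<le> ?R" for n
  proof -
    define I where "I = (\<integral>\<^sup>+ x. G n x ^\<^sub>e r \<partial>M)"
    have "I \<le> (\<integral>\<^sup>+ x. of_nat n ^\<^sub>e r * indicator (A n) x \<partial>M)"
      unfolding I_def G_def using r
      by (intro nn_integral_mono) (auto simp: indicator_def zero_ennpow intro!: ennpow_mono)
    also have "\<dots> = of_nat n ^\<^sub>e r * emeasure M (A n)"
      by (simp add: nn_integral_cmult_indicator)
    also have "\<dots> < \<top>"
      using A(3)[of n] r ennpow_less_top_iff[of r "of_nat n"]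
      by (simp add: ennreal_mult_less_top less_top of_nat_less_top)
    finally have I_fin: "I < \<top>" .
    \<comment> \<open>Only the single factor \<open>G n x\<close> is enlarged to \<open>H x\<close>.
      The power \<open>r - 1\<close> keeps the truncation, so that Hoelder returns a power of the
      finite number \<open>I\<close>.\<close>
    have "I = (\<integral>\<^sup>+ x. G n x ^\<^sub>e (r - 1) * G n x \<partial>M)"
      unfolding I_def using ennpow_add[of "r - 1" 1] r by simp
    also have "\<dots> \<le> (\<integral>\<^sup>+ x. G n x ^\<^sub>e (r - 1) * H x \<partial>M)"
      by (intro nn_integral_mono mult_left_mono G_le) auto
    also have "\<dots> = (\<integral>\<^sup>+ x. (\<integral>\<^sup>+ t. G n x ^\<^sub>e (r - 1) * F x t \<partial>N) \<partial>M)"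
      unfolding H_def by (intro nn_integral_cong) (simp add: nn_integral_cmult)
    also have "\<dots> = (\<integral>\<^sup>+ t. (\<integral>\<^sup>+ x. G n x ^\<^sub>e (r - 1) * F x t \<partial>M) \<partial>N)"
      by (intro P.Fubini'[symmetric]) measurable
    also have "\<dots> \<le> (\<integral>\<^sup>+ t. (\<integral>\<^sup>+ x. (G n x ^\<^sub>e (r - 1)) ^\<^sub>e r' \<partial>M) ^\<^sub>e (1 / r')
        * (\<integral>\<^sup>+ x. F x t ^\<^sub>e r \<partial>M) ^\<^sub>e (1 / r) \<partial>N)"
      using r r' by (intro nn_integral_mono nn_integral_Holder) auto
    also have "\<dots> = I ^\<^sub>e (1 / r') * ?R"
      using r' by (simp add: ennpow_ennpow I_def nn_integral_cmult)
    finally have *: "I \<le> I ^\<^sub>e (1 / r') * ?R" .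
    show ?thesis
    proof (cases "I = 0")
      case True
      then show ?thesis
        using r by (simp add: I_def[symmetric] zero_ennpow)
    next
      case False
      have "I ^\<^sub>e (1 / r') * I ^\<^sub>e (1 / r) \<le> I ^\<^sub>e (1 / r') * ?R"
        using * r r' ennpow_add[of "1 / r'" "1 / r" I] by simp
      moreover have "I ^\<^sub>e (1 / r') \<noteq> 0" "I ^\<^sub>e (1 / r') \<noteq> \<top>"
        using False I_fin r' by (auto simp: ennpow_eq_0_iff ennpow_eq_top_iff)
      ultimately show ?thesis
        by (auto simp: I_def[symmetric] ennreal_mult_le_mult_iff)
    qed
  qed
  have inc: "incseq G"
    using A(4) unfolding G_def incseq_def le_fun_def
    by (auto simp: indicator_def min.coboundedI2)
  have SUP_G: "(SUP n. G n x) = H x" if "x \<in> space M" for x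
  proof -
    obtain m where "x \<in> A m"
      using A(2) \<open>x \<in> space M\<close> by blast
    then have "eventually (\<lambda>n. x \<in> A n) sequentially"
      using A(4) by (auto simp: eventually_sequentially incseq_def)
    then have "eventually (\<lambda>n. min (H x) (of_nat n) = G n x) sequentially"
      by eventually_elim (simp add: G_def)
    moreover have "(\<lambda>n. min (H x) (of_nat n)) \<longlonglongrightarrow> min (H x) \<top>"
      by (intro tendsto_min tendsto_const of_nat_tendsto_top_ennreal)
    ultimately have "(\<lambda>n. G n x) \<longlonglongrightarrow> H x"
      by (simp add: tendsto_cong)
    moreover have "(\<lambda>n. G n x) \<longlonglongrightarrow> (SUP n. G n x)"
      using inc by (intro LIMSEQ_SUP) (simp add: incseq_def le_fun_def)
    ultimately show ?thesis
      by (metis LIMSEQ_unique)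
  qed
  \<comment> \<open>Monotone convergence carries the bound, uniform in \<open>n\<close>, from the
    truncations to \<open>H\<close>.\<close>
  have "(\<integral>\<^sup>+ x. H x ^\<^sub>e r \<partial>M) = (\<integral>\<^sup>+ x. (SUP n. G n x ^\<^sub>e r) \<partial>M)"
    using r by (intro nn_integral_cong) (simp add: ennpow_SUP flip: SUP_G)
  also have "\<dots> = (SUP n. \<integral>\<^sup>+ x. G n x ^\<^sub>e r \<partial>M)"
    using inc r by (intro nn_integral_monotone_convergence_SUP)
      (auto simp: incseq_def le_fun_def intro!: ennpow_mono)
  finally have "(\<integral>\<^sup>+ x. H x ^\<^sub>e r \<partial>M) ^\<^sub>e (1 / r) = (SUP n. (\<integral>\<^sup>+ x. G n x ^\<^sub>e r \<partial>M) ^\<^sub>e (1 / r))"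
    using r by (simp add: ennpow_SUP)
  also have "\<dots> \<le> ?R"
    by (intro SUP_least bound)
  finally show ?thesis
    by (simp add: H_def)
qed

section \<open>Null sets of product measures and measurability of essential suprema\<close>

text \<open>Mixed norms integrate the first coordinate innermost, the reverse of the order in
  \<open>AE_pair\<close>. As \<open>P\<close> is an arbitrary predicate, the order is reversed by
  transporting the null set along the coordinate swap.\<close>

lemma (in pair_sigma_finite) AE_pair_swap:
  assumes "AE z in M1 \<Otimes>\<^sub>M M2. P z"
  shows "AE y in M2. AE x in M1. P (x, y)"
proof -
  interpret Q: pair_sigma_finite M2 M1 ..
  have "AE z in distr (M2 \<Otimes>\<^sub>M M1) (M1 \<Otimes>\<^sub>M M2) (\<lambda>(x, y). (y, x)). P z"
    using assms by (subst (asm) distr_pair_swap)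
  then have "AE z in M2 \<Otimes>\<^sub>M M1. P (case z of (x, y) \<Rightarrow> (y, x))"
    by (rule AE_distrD[rotated]) measurable
  from Q.AE_pair[OF this] show ?thesis
    by simp
qed

text \<open>The essential supremum is at most \<open>c\<close> exactly when the section where
  \<open>g\<close> exceeds \<open>c\<close> is null, and the measure of a section depends measurably
  on \<open>t\<close>.\<close>

lemma borel_measurable_esssup:
  fixes g :: "'a \<Rightarrow> 'b \<Rightarrow> ennreal"
  assumes "sigma_finite_measure M"
    and [measurable]: "(\<lambda>(s, t). g s t) \<in> borel_measurable (M \<Otimes>\<^sub>M N)"
  shows "(\<lambda>t. esssup M (\<lambda>s. g s t)) \<in> borel_measurable N"
proof (rule borel_measurableI_le)
  interpret sigma_finite_measure M by fact
  fix c
  have "esssup M (\<lambda>s. g s t) \<le> c \<longleftrightarrow> emeasure M {s \<in> space M. c < g s t} = 0"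
    if [measurable]: "t \<in> space N" for t
  proof -
    have "esssup M (\<lambda>s. g s t) \<le> c \<longleftrightarrow> (AE s in M. g s t \<le> c)"
      using esssup_AE[of "\<lambda>s. g s t" M] by (auto intro!: esssup_I elim!: order_trans)
    then show ?thesis
      by (simp add: AE_iff_measurable[OF _ refl] not_le)
  qed
  then have "{t \<in> space N. esssup M (\<lambda>s. g s t) \<le> c}
      = {t \<in> space N. emeasure M {s \<in> space M. c < g s t} = 0}"
    by auto
  also have "\<dots> \<in> sets N"
    by measurable
  finally show "{t \<in> space N. esssup M (\<lambda>s. g s t) \<le> c} \<in> sets N" .
qed

section \<open>Mixed norms of functions with values in the extended nonnegative numbers\<close>

text \<open>Allowing infinite values makes it possible to nest these norms and to apply them to
  integrals not yet known to converge. Inserting \<open>ennreal (norm (f z))\<close> recovers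
  \<open>mixed_norm\<close>.\<close>

definition nn_mixed_norm ::
  "real \<Rightarrow> real \<Rightarrow> 'a measure \<Rightarrow> 'b measure \<Rightarrow> ('a \<times> 'b \<Rightarrow> ennreal) \<Rightarrow> ennreal" where
  "nn_mixed_norm p q M N g = (\<integral>\<^sup>+ y. (\<integral>\<^sup>+ x. g (x, y) ^\<^sub>e p \<partial>M) ^\<^sub>e (q / p) \<partial>N) ^\<^sub>e (1 / q)"

lemma borel_measurable_nn_mixed_norm [measurable]:
  assumes "sigma_finite_measure M" "sigma_finite_measure N"
    and [measurable]: "(\<lambda>(s, z). g s z) \<in> borel_measurable (S \<Otimes>\<^sub>M (M \<Otimes>\<^sub>M N))"
  shows "(\<lambda>s. nn_mixed_norm p q M N (g s)) \<in> borel_measurable S"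
proof -
  interpret pair_sigma_finite M N
    using assms by (simp add: pair_sigma_finite_def)
  show ?thesis
    unfolding nn_mixed_norm_def by measurable
qed

lemma nn_mixed_norm_mono_AE:
  assumes "sigma_finite_measure M" "sigma_finite_measure N" "0 < p" "0 < q"
    and "AE z in M \<Otimes>\<^sub>M N. f z \<le> g z"
  shows "nn_mixed_norm p q M N f \<le> nn_mixed_norm p q M N g"
proof -
  interpret pair_sigma_finite M N
    using assms by (simp add: pair_sigma_finite_def)
  have "AE y in N. AE x in M. f (x, y) \<le> g (x, y)"
    using assms(5) by (rule AE_pair_swap)
  then have "AE y in N. (\<integral>\<^sup>+ x. f (x, y) ^\<^sub>e p \<partial>M) ^\<^sub>e (q / p) \<le> (\<integral>\<^sup>+ x. g (x, y) ^\<^sub>e p \<partial>M) ^\<^sub>e (q / p)"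
    using assms(3,4)
    by (auto elim!: eventually_mono intro!: ennpow_mono nn_integral_mono_AE)
  then show ?thesis
    unfolding nn_mixed_norm_def using assms(3,4) by (intro ennpow_mono nn_integral_mono_AE) auto
qed

lemma nn_mixed_norm_cmult:
  assumes "sigma_finite_measure M" "0 < p" "0 < q"
    and [measurable]: "g \<in> borel_measurable (M \<Otimes>\<^sub>M N)"
  shows "nn_mixed_norm p q M N (\<lambda>z. c * g z) = c * nn_mixed_norm p q M N g"
proof -
  interpret sigma_finite_measure M by fact
  have "(\<integral>\<^sup>+ y. (\<integral>\<^sup>+ x. (c * g (x, y)) ^\<^sub>e p \<partial>M) ^\<^sub>e (q / p) \<partial>N)
      = (\<integral>\<^sup>+ y. c ^\<^sub>e q * (\<integral>\<^sup>+ x. g (x, y) ^\<^sub>e p \<partial>M) ^\<^sub>e (q / p) \<partial>N)"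
    using assms(2,3) by (intro nn_integral_cong) (simp add: ennpow_mult ennpow_ennpow nn_integral_cmult)
  also have "\<dots> = c ^\<^sub>e q * (\<integral>\<^sup>+ y. (\<integral>\<^sup>+ x. g (x, y) ^\<^sub>e p \<partial>M) ^\<^sub>e (q / p) \<partial>N)"
    by (rule nn_integral_cmult) measurable
  finally show ?thesis
    unfolding nn_mixed_norm_def using assms(2,3) by (simp add: ennpow_mult ennpow_ennpow)
qed

text \<open>This removes an outer root inside a mixed norm by rescaling its exponents, so that
  Minkowski's inequality for plain integrals applies.\<close>

lemma nn_mixed_norm_ennpow:
  assumes "0 < p" "0 < q" "0 < r"
  shows "nn_mixed_norm p q M N g ^\<^sub>e r = nn_mixed_norm (p / r) (q / r) M N (\<lambda>z. g z ^\<^sub>e r)"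
  unfolding nn_mixed_norm_def using assms by (simp add: ennpow_ennpow)

text \<open>Minkowski's inequality is used twice, first in \<open>x\<close> for fixed
  \<open>y\<close> and then in \<open>y\<close>.\<close>

lemma nn_mixed_norm_Minkowski:
  fixes G :: "'a \<times> 'b \<Rightarrow> 'c \<Rightarrow> ennreal"
  assumes "sigma_finite_measure M" "sigma_finite_measure N" "sigma_finite_measure S"
    and "1 \<le> p" "1 \<le> q"
    and [measurable]: "(\<lambda>(z, s). G z s) \<in> borel_measurable ((M \<Otimes>\<^sub>M N) \<Otimes>\<^sub>M S)"
  shows "nn_mixed_norm p q M N (\<lambda>z. \<integral>\<^sup>+ s. G z s \<partial>S) \<le> (\<integral>\<^sup>+ s. nn_mixed_norm p q M N (\<lambda>z. G z s) \<partial>S)"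
proof -
  interpret pair_sigma_finite M N
    using assms by (simp add: pair_sigma_finite_def)
  interpret S: sigma_finite_measure S by fact
  let ?I = "\<lambda>y s. (\<integral>\<^sup>+ x. G (x, y) s ^\<^sub>e p \<partial>M) ^\<^sub>e (1 / p)"
  have "nn_mixed_norm p q M N (\<lambda>z. \<integral>\<^sup>+ s. G z s \<partial>S)
      = (\<integral>\<^sup>+ y. ((\<integral>\<^sup>+ x. (\<integral>\<^sup>+ s. G (x, y) s \<partial>S) ^\<^sub>e p \<partial>M) ^\<^sub>e (1 / p)) ^\<^sub>e q \<partial>N) ^\<^sub>e (1 / q)"
    unfolding nn_mixed_norm_def using assms(4,5) by (simp add: ennpow_ennpow)
  also have "\<dots> \<le> (\<integral>\<^sup>+ y. (\<integral>\<^sup>+ s. ?I y s \<partial>S) ^\<^sub>e q \<partial>N) ^\<^sub>e (1 / q)"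
    using assms by (intro ennpow_mono nn_integral_mono nn_integral_Minkowski) auto
  also have "\<dots> \<le> (\<integral>\<^sup>+ s. (\<integral>\<^sup>+ y. ?I y s ^\<^sub>e q \<partial>N) ^\<^sub>e (1 / q) \<partial>S)"
    using assms by (intro nn_integral_Minkowski) auto
  also have "\<dots> = (\<integral>\<^sup>+ s. nn_mixed_norm p q M N (\<lambda>z. G z s) \<partial>S)"
    unfolding nn_mixed_norm_def using assms(4,5) by (simp add: ennpow_ennpow)
  finally show ?thesis .
qed

text \<open>After raising to the power \<open>p\<close>, the outer integral over \<open>t\<close> is
  pulled out of a norm with exponents \<open>q1 / p\<close> and \<open>q2 / p\<close>; these are at
  least 1 because \<open>p\<close> is below both. The integral over \<open>s\<close> is then pulled
  out with the original exponents.\<close>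

lemma nn_mixed_norm_Minkowski_1_p:
  fixes G :: "'a \<times> 'b \<Rightarrow> 'c \<times> 'd \<Rightarrow> ennreal"
  assumes sf: "sigma_finite_measure N1" "sigma_finite_measure N2"
      "sigma_finite_measure M1" "sigma_finite_measure M2"
    and p: "1 \<le> p" "p \<le> q1" "p \<le> q2"
    and [measurable]: "(\<lambda>(z, w). G z w) \<in> borel_measurable ((N1 \<Otimes>\<^sub>M N2) \<Otimes>\<^sub>M (M1 \<Otimes>\<^sub>M M2))"
  shows "nn_mixed_norm q1 q2 N1 N2 (\<lambda>z. nn_mixed_norm 1 p M1 M2 (G z))
      \<le> nn_mixed_norm 1 p M1 M2 (\<lambda>w. nn_mixed_norm q1 q2 N1 N2 (\<lambda>z. G z w))"
proof -
  interpret M: pair_sigma_finite M1 M2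
    using assms by (simp add: pair_sigma_finite_def)
  interpret N: pair_sigma_finite N1 N2
    using assms by (simp add: pair_sigma_finite_def)
  have "nn_mixed_norm q1 q2 N1 N2 (\<lambda>z. nn_mixed_norm 1 p M1 M2 (G z)) ^\<^sub>e p
      = nn_mixed_norm (q1 / p) (q2 / p) N1 N2 (\<lambda>z. \<integral>\<^sup>+ t. (\<integral>\<^sup>+ s. G z (s, t) \<partial>M1) ^\<^sub>e p \<partial>M2)"
    using p by (subst nn_mixed_norm_ennpow) (simp_all add: nn_mixed_norm_def[of 1] ennpow_ennpow)
  also have "\<dots> \<le> (\<integral>\<^sup>+ t. nn_mixed_norm (q1 / p) (q2 / p) N1 N2
      (\<lambda>z. (\<integral>\<^sup>+ s. G z (s, t) \<partial>M1) ^\<^sub>e p) \<partial>M2)"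
    using p sf by (intro nn_mixed_norm_Minkowski) auto
  also have "\<dots> = (\<integral>\<^sup>+ t. nn_mixed_norm q1 q2 N1 N2 (\<lambda>z. \<integral>\<^sup>+ s. G z (s, t) \<partial>M1) ^\<^sub>e p \<partial>M2)"
    using p by (simp add: nn_mixed_norm_ennpow)
  also have "\<dots> \<le> (\<integral>\<^sup>+ t. (\<integral>\<^sup>+ s. nn_mixed_norm q1 q2 N1 N2 (\<lambda>z. G z (s, t)) \<partial>M1) ^\<^sub>e p \<partial>M2)"
    using p sf by (intro nn_integral_mono ennpow_mono nn_mixed_norm_Minkowski) auto
  finally show ?thesis
    using p ennpow_inverse_le_iff[of "1 / p"] by (simp add: nn_mixed_norm_def[of 1])
qed

section \<open>The Schur test for a factorised kernel\<close>

text \<open>The argument depends on the kernel only through a factorisation. In the application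
  \<open>g\<close> and \<open>h\<close> are \<open>h1\<close> and \<open>h2\<close>,
  \<open>b\<close> is the product of the \<delta>-powers, and \<open>a\<close> is the product of the
  \<gamma>-powers with the weight \<open>h1\<close> included, whence the form
  \<open>k * g \<le> a * b\<close>.\<close>

lemma mixed_Schur_test:
  fixes k a b :: "'a \<times> 'b \<Rightarrow> 'c \<times> 'd \<Rightarrow> ennreal" and \<phi> g h :: "_ \<Rightarrow> ennreal"
  assumes sf: "sigma_finite_measure N1" "sigma_finite_measure N2"
      "sigma_finite_measure M1" "sigma_finite_measure M2"
    and p: "1 < p" "1 / p + 1 / p' = 1" "p \<le> q1" "p \<le> q2"
    and meas[measurable]: "(\<lambda>(z, w). k z w) \<in> borel_measurable ((N1 \<Otimes>\<^sub>M N2) \<Otimes>\<^sub>M (M1 \<Otimes>\<^sub>M M2))"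
      "(\<lambda>(z, w). a z w) \<in> borel_measurable ((N1 \<Otimes>\<^sub>M N2) \<Otimes>\<^sub>M (M1 \<Otimes>\<^sub>M M2))"
      "(\<lambda>(z, w). b z w) \<in> borel_measurable ((N1 \<Otimes>\<^sub>M N2) \<Otimes>\<^sub>M (M1 \<Otimes>\<^sub>M M2))"
      "g \<in> borel_measurable (M1 \<Otimes>\<^sub>M M2)" "\<phi> \<in> borel_measurable (M1 \<Otimes>\<^sub>M M2)"
      "h \<in> borel_measurable (N1 \<Otimes>\<^sub>M N2)"
    and g: "\<And>w. w \<in> space (M1 \<Otimes>\<^sub>M M2) \<Longrightarrow> 0 < g w \<and> g w < \<top>"
    and k: "\<And>z w. z \<in> space (N1 \<Otimes>\<^sub>M N2) \<Longrightarrow> w \<in> space (M1 \<Otimes>\<^sub>M M2) \<Longrightarrow> k z w * g w \<le> a z w * b z w"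
    and a: "AE z in N1 \<Otimes>\<^sub>M N2.
      (\<integral>\<^sup>+ t. esssup M1 (\<lambda>s. a z (s, t)) ^\<^sub>e p' \<partial>M2) \<le> C1 * h z ^\<^sub>e p'"
    and b: "AE w in M1 \<Otimes>\<^sub>M M2.
      (\<integral>\<^sup>+ y. (\<integral>\<^sup>+ x. (b (x, y) w * h (x, y)) ^\<^sub>e q1 \<partial>N1) ^\<^sub>e (q2 / q1) \<partial>N2) \<le> C2 * g w ^\<^sub>e q2"
  shows "nn_mixed_norm q1 q2 N1 N2 (\<lambda>z. \<integral>\<^sup>+ t. \<integral>\<^sup>+ s. k z (s, t) * \<phi> (s, t) \<partial>M1 \<partial>M2)
      \<le> C1 ^\<^sub>e (1 / p') * C2 ^\<^sub>e (1 / q2) * nn_mixed_norm 1 p M1 M2 \<phi>"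
proof -
  interpret M: pair_sigma_finite M1 M2
    using sf by (simp add: pair_sigma_finite_def)
  interpret N: pair_sigma_finite N1 N2
    using sf by (simp add: pair_sigma_finite_def)
  have p': "1 < p'"
  proof -
    have "1 / p < 1" "0 < 1 / p" using p by auto
    then have "0 < 1 / p'" "1 / p' < 1" using p(2) by linarith+
    then show ?thesis by (simp add: field_simps split: if_splits)
  qed
  \<comment> \<open>Since \<open>g\<close> is positive and finite, dividing by it loses nothing:
    \<open>g * c\<close> gives back \<open>\<phi>\<close> even where \<open>\<phi>\<close> is
    infinite.\<close>
  define c where "c w = \<phi> w / g w" for w
  have c[measurable]: "c \<in> borel_measurable (M1 \<Otimes>\<^sub>M M2)"
    unfolding c_def by measurable
  have g_c: "g w * c w = \<phi> w" if "w \<in> space (M1 \<Otimes>\<^sub>M M2)" for w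
  proof -
    have "g w \<noteq> 0" "g w \<noteq> \<top>"
      using g[OF that] by auto
    then show ?thesis
      by (simp add: c_def ennreal_times_divide ennreal_mult_divide_eq mult.commute[of "g w"])
  qed
  define G where "G z w = (b z w * h z) * c w" for z w
  have G[measurable]: "(\<lambda>(z, w). G z w) \<in> borel_measurable ((N1 \<Otimes>\<^sub>M N2) \<Otimes>\<^sub>M (M1 \<Otimes>\<^sub>M M2))"
    unfolding G_def by measurable
  have "AE z in N1 \<Otimes>\<^sub>M N2. (\<integral>\<^sup>+ t. \<integral>\<^sup>+ s. k z (s, t) * \<phi> (s, t) \<partial>M1 \<partial>M2)
      \<le> C1 ^\<^sub>e (1 / p') * nn_mixed_norm 1 p M1 M2 (G z)"
    using a AE_space
  proof eventually_elim
    case (elim z)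
    note z[measurable] = elim(2)
    define u where "u t = esssup M1 (\<lambda>s. a z (s, t))" for t
    have u[measurable]: "u \<in> borel_measurable M2"
      unfolding u_def using sf(3) by (rule borel_measurable_esssup) measurable
    \<comment> \<open>Hoelder in \<open>s\<close> with the exponents \<infinity> and 1: for almost
      every \<open>s\<close> the factor \<open>a\<close> is at most \<open>u t\<close>, which then
      leaves the inner integral.\<close>
    have "(\<integral>\<^sup>+ t. \<integral>\<^sup>+ s. k z (s, t) * \<phi> (s, t) \<partial>M1 \<partial>M2) \<le> (\<integral>\<^sup>+ t. u t * (\<integral>\<^sup>+ s. b z (s, t) * c (s, t) \<partial>M1) \<partial>M2)"
    proof (rule nn_integral_mono)
      fix t assume t[measurable]: "t \<in> space M2"
      have "AE s in M1. k z (s, t) * \<phi> (s, t) \<le> u t * (b z (s, t) * c (s, t))"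
        using esssup_AE[of "\<lambda>s. a z (s, t)" M1] AE_space
      proof eventually_elim
        case (elim s)
        then have st: "(s, t) \<in> space (M1 \<Otimes>\<^sub>M M2)"
          using t by (simp add: space_pair_measure)
        have "k z (s, t) * \<phi> (s, t) = (k z (s, t) * g (s, t)) * c (s, t)"
          by (simp add: g_c[OF st] mult.assoc)
        also have "\<dots> \<le> (a z (s, t) * b z (s, t)) * c (s, t)"
          by (intro mult_right_mono k z st) auto
        also have "\<dots> \<le> (u t * b z (s, t)) * c (s, t)"
          using elim(1) by (intro mult_right_mono) (auto simp: u_def)
        finally show ?case
          by (simp add: mult.assoc)
      qed
      then have "(\<integral>\<^sup>+ s. k z (s, t) * \<phi> (s, t) \<partial>M1) \<le> (\<integral>\<^sup>+ s. u t * (b z (s, t) * c (s, t)) \<partial>M1)"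
        by (rule nn_integral_mono_AE)
      also have "\<dots> = u t * (\<integral>\<^sup>+ s. b z (s, t) * c (s, t) \<partial>M1)"
        by (rule nn_integral_cmult) measurable
      finally show "(\<integral>\<^sup>+ s. k z (s, t) * \<phi> (s, t) \<partial>M1) \<le> u t * (\<integral>\<^sup>+ s. b z (s, t) * c (s, t) \<partial>M1)" .
    qed
    also have "\<dots> \<le> (\<integral>\<^sup>+ t. u t ^\<^sub>e p' \<partial>M2) ^\<^sub>e (1 / p')
        * (\<integral>\<^sup>+ t. (\<integral>\<^sup>+ s. b z (s, t) * c (s, t) \<partial>M1) ^\<^sub>e p \<partial>M2) ^\<^sub>e (1 / p)"
      using p p' by (intro nn_integral_Holder) auto
    also have "\<dots> \<le> (C1 * h z ^\<^sub>e p') ^\<^sub>e (1 / p')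
        * (\<integral>\<^sup>+ t. (\<integral>\<^sup>+ s. b z (s, t) * c (s, t) \<partial>M1) ^\<^sub>e p \<partial>M2) ^\<^sub>e (1 / p)"
      using elim(1) p' by (intro mult_right_mono ennpow_mono) (auto simp: u_def)
    also have "(C1 * h z ^\<^sub>e p') ^\<^sub>e (1 / p') = C1 ^\<^sub>e (1 / p') * h z"
      using p' by (simp add: ennpow_mult ennpow_ennpow)
    also have "C1 ^\<^sub>e (1 / p') * h z * (\<integral>\<^sup>+ t. (\<integral>\<^sup>+ s. b z (s, t) * c (s, t) \<partial>M1) ^\<^sub>e p \<partial>M2) ^\<^sub>e (1 / p)
        = C1 ^\<^sub>e (1 / p') * (h z * nn_mixed_norm 1 p M1 M2 (\<lambda>w. b z w * c w))"
      by (simp add: nn_mixed_norm_def mult.assoc)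
    \<comment> \<open>The factor \<open>h z\<close> is moved under the norm in \<open>w\<close>, so
      that after the exchange of norms it stands next to \<open>b\<close>, as in the second
      hypothesis.\<close>
    also have "h z * nn_mixed_norm 1 p M1 M2 (\<lambda>w. b z w * c w) = nn_mixed_norm 1 p M1 M2 (G z)"
      using p sf by (subst nn_mixed_norm_cmult[symmetric]) (auto simp: G_def[abs_def] mult_ac)
    finally show ?case .
  qed
  then have "nn_mixed_norm q1 q2 N1 N2 (\<lambda>z. \<integral>\<^sup>+ t. \<integral>\<^sup>+ s. k z (s, t) * \<phi> (s, t) \<partial>M1 \<partial>M2)
      \<le> nn_mixed_norm q1 q2 N1 N2 (\<lambda>z. C1 ^\<^sub>e (1 / p') * nn_mixed_norm 1 p M1 M2 (G z))"
    using p sf by (intro nn_mixed_norm_mono_AE) auto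
  also have "\<dots> = C1 ^\<^sub>e (1 / p') * nn_mixed_norm q1 q2 N1 N2 (\<lambda>z. nn_mixed_norm 1 p M1 M2 (G z))"
    using p sf by (intro nn_mixed_norm_cmult borel_measurable_nn_mixed_norm) auto
  also have "\<dots> \<le> C1 ^\<^sub>e (1 / p')
      * nn_mixed_norm 1 p M1 M2 (\<lambda>w. nn_mixed_norm q1 q2 N1 N2 (\<lambda>z. G z w))"
    using p sf by (intro mult_left_mono nn_mixed_norm_Minkowski_1_p) auto
  also have "nn_mixed_norm 1 p M1 M2 (\<lambda>w. nn_mixed_norm q1 q2 N1 N2 (\<lambda>z. G z w))
      \<le> nn_mixed_norm 1 p M1 M2 (\<lambda>w. C2 ^\<^sub>e (1 / q2) * \<phi> w)"
  proof (rule nn_mixed_norm_mono_AE)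
    show "AE w in M1 \<Otimes>\<^sub>M M2. nn_mixed_norm q1 q2 N1 N2 (\<lambda>z. G z w) \<le> C2 ^\<^sub>e (1 / q2) * \<phi> w"
      using b AE_space
    proof eventually_elim
      case (elim w)
      note w[measurable] = elim(2)
      \<comment> \<open>For fixed \<open>w\<close> the factor \<open>c w\<close> is constant in
        \<open>z\<close>; the factor \<open>g w\<close> produced by hypothesis \<open>b\<close> then
        turns it back into \<open>\<phi> w\<close>.\<close>
      have "nn_mixed_norm q1 q2 N1 N2 (\<lambda>z. G z w) = c w * nn_mixed_norm q1 q2 N1 N2 (\<lambda>z. b z w * h z)"
        using p sf by (subst nn_mixed_norm_cmult[symmetric]) (auto simp: G_def mult_ac)
      also have "\<dots> \<le> c w * (C2 * g w ^\<^sub>e q2) ^\<^sub>e (1 / q2)"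
        unfolding nn_mixed_norm_def using elim(1) p by (intro mult_left_mono ennpow_mono) auto
      also have "\<dots> = C2 ^\<^sub>e (1 / q2) * (g w * c w)"
        using p by (simp add: ennpow_mult ennpow_ennpow mult_ac)
      finally show ?case
        by (simp add: g_c[OF elim(2)])
    qed
  qed (use p sf in auto)
  also have "\<dots> = C2 ^\<^sub>e (1 / q2) * nn_mixed_norm 1 p M1 M2 \<phi>"
    using p sf by (intro nn_mixed_norm_cmult) auto
  finally show ?thesis
    by (simp add: mult.assoc mult_left_mono)
qed

section \<open>Finiteness almost everywhere and norm bounds for Bochner integrals\<close>

text \<open>A finite integral has an almost everywhere finite integrand; this is used for the outer
  and then for the inner integral. It later yields absolute convergence from the norm estimate
  itself.\<close>

lemma nn_mixed_norm_finite_AE: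
  assumes "sigma_finite_measure M" "sigma_finite_measure N" "0 < p" "0 < q"
    and [measurable]: "g \<in> borel_measurable (M \<Otimes>\<^sub>M N)"
    and "nn_mixed_norm p q M N g < \<top>"
  shows "AE z in M \<Otimes>\<^sub>M N. g z < \<top>"
proof -
  interpret pair_sigma_finite M N
    using assms by (simp add: pair_sigma_finite_def)
  have "(\<integral>\<^sup>+ y. (\<integral>\<^sup>+ x. g (x, y) ^\<^sub>e p \<partial>M) ^\<^sub>e (q / p) \<partial>N) \<noteq> \<infinity>"
    using assms(4,6) by (simp add: nn_mixed_norm_def ennpow_less_top_iff)
  then have "AE y in N. (\<integral>\<^sup>+ x. g (x, y) ^\<^sub>e p \<partial>M) ^\<^sub>e (q / p) \<noteq> \<infinity>"
    by (intro nn_integral_PInf_AE) measurable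
  then have "AE y in N. AE x in M. g (x, y) < \<top>"
    using AE_space
  proof eventually_elim
    case (elim y)
    note [measurable] = elim(2)
    have "(\<integral>\<^sup>+ x. g (x, y) ^\<^sub>e p \<partial>M) \<noteq> \<infinity>"
      using elim assms(3,4) by (simp add: ennpow_eq_top_iff)
    then have "AE x in M. g (x, y) ^\<^sub>e p \<noteq> \<infinity>"
      by (intro nn_integral_PInf_AE) measurable
    then show ?case
      using assms(3) by (auto simp: ennpow_eq_top_iff less_top)
  qed
  then have "AE x in M. AE y in N. g (x, y) < \<top>"
    by (subst AE_commute) auto
  then have "AE z in M \<Otimes>\<^sub>M N. g (fst z, snd z) < \<top>"
    by (subst AE_pair_iff[symmetric]) auto
  then show ?thesis
    by simp
qed

text \<open>A function that is not integrable has Bochner integral 0 by convention, so the bound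
  persists for it.\<close>

lemma norm_lebesgue_integral_le_nn_integral:
  fixes f :: "'a \<Rightarrow> 'b::{banach, second_countable_topology}"
  shows "ennreal (norm (integral\<^sup>L M f)) \<le> (\<integral>\<^sup>+ x. ennreal (norm (f x)) \<partial>M)"
  by (cases "integrable M f") (auto simp: not_integrable_integral_eq integral_norm_bound_ennreal)

section \<open>Boundedness of the integral operator\<close>

text \<open>The integrability claim ensures that, for almost every point, \<open>T f\<close> is a
  convergent integral and not the default value 0 of a divergent one.\<close>

theorem proposition3p3:
  fixes X \<mu>1 \<mu>2 \<nu>1 \<nu>2 :: "'a measure"
    and K1 K2 h1 h2 :: "'a \<times> 'a \<Rightarrow> real"
    and T :: "('a \<times> 'a \<Rightarrow> 'b::{real_normed_field, banach, second_countable_topology}) \<Rightarrow> 'a \<times> 'a \<Rightarrow> 'b"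
    and p2 p2' q1 q2 \<gamma>1 \<gamma>2 \<delta>1 \<delta>2 C1 C2 :: real
  assumes "sets \<mu>1 = sets X" "sets \<mu>2 = sets X" "sets \<nu>1 = sets X" "sets \<nu>2 = sets X"
    and "sigma_finite_measure \<mu>1" "sigma_finite_measure \<mu>2"
    and "sigma_finite_measure \<nu>1" "sigma_finite_measure \<nu>2"
    and "K1 \<in> borel_measurable (X \<Otimes>\<^sub>M X)" "K2 \<in> borel_measurable (X \<Otimes>\<^sub>M X)"
    and "\<And>z. z \<in> space (X \<Otimes>\<^sub>M X) \<Longrightarrow> 0 \<le> K1 z" "\<And>z. z \<in> space (X \<Otimes>\<^sub>M X) \<Longrightarrow> 0 \<le> K2 z"
    and T_def: "\<And>f x y. T f (x, y) = (LINT t|\<mu>2. LINT s|\<mu>1. (K1 (x, s) * K2 (y, t)) *\<^sub>R f (s, t))"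
    and "1 < p2" "1 / p2 + 1 / p2' = 1"
    and "1 < q1" "1 < q2" "p2 \<le> min q1 q2"
    and "\<gamma>1 + \<delta>1 = 1" "\<gamma>2 + \<delta>2 = 1"
    and "h1 \<in> borel_measurable (X \<Otimes>\<^sub>M X)" "h2 \<in> borel_measurable (X \<Otimes>\<^sub>M X)"
    and "\<And>z. z \<in> space (X \<Otimes>\<^sub>M X) \<Longrightarrow> 0 < h1 z" "\<And>z. z \<in> space (X \<Otimes>\<^sub>M X) \<Longrightarrow> 0 < h2 z"
    and "0 < C1" "0 < C2"
    and "AE (x, y) in \<nu>1 \<Otimes>\<^sub>M \<nu>2.
           (\<integral>\<^sup>+ t. (esssup \<mu>1 (\<lambda>s. ennreal (K1 (x, s)) ^\<^sub>e \<gamma>1 * ennreal (K2 (y, t)) ^\<^sub>e \<gamma>2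
                     * ennreal (h1 (s, t)))) ^\<^sub>e p2' \<partial>\<mu>2)
             \<le> ennreal C1 * ennreal (h2 (x, y)) ^\<^sub>e p2'"
    and "AE (s, t) in \<mu>1 \<Otimes>\<^sub>M \<mu>2.
           (\<integral>\<^sup>+ y. (\<integral>\<^sup>+ x. ennreal (K1 (x, s)) ^\<^sub>e (\<delta>1 * q1) * ennreal (K2 (y, t)) ^\<^sub>e (\<delta>2 * q1)
                     * ennreal (h2 (x, y)) ^\<^sub>e q1 \<partial>\<nu>1) ^\<^sub>e (q2 / q1) \<partial>\<nu>2)
             \<le> ennreal C2 * ennreal (h1 (s, t)) ^\<^sub>e q2"
  shows "(\<forall>f \<in> (mixed_Lp (1, p2) (\<mu>1, \<mu>2) :: ('a \<times> 'a \<Rightarrow> 'b) set). AE (x, y) in \<nu>1 \<Otimes>\<^sub>M \<nu>2.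
            integrable (\<mu>1 \<Otimes>\<^sub>M \<mu>2) (\<lambda>(s, t). (K1 (x, s) * K2 (y, t)) *\<^sub>R f (s, t)))
       \<and> mixed_bounded_operator (1, p2) (\<mu>1, \<mu>2) (q1, q2) (\<nu>1, \<nu>2) T
       \<and> mixed_op_norm (1, p2) (\<mu>1, \<mu>2) (q1, q2) (\<nu>1, \<nu>2) T
           \<le> ennreal (C1 powr (1 / p2') * C2 powr (1 / q2))"
proof -
  interpret M: pair_sigma_finite \<mu>1 \<mu>2
    using assms(5,6) by (simp add: pair_sigma_finite_def)
  interpret N: pair_sigma_finite \<nu>1 \<nu>2
    using assms(7,8) by (simp add: pair_sigma_finite_def)
  note [measurable_cong] = assms(1-4)
  note [measurable] = assms(9,10,21,22)
  have space_eq: "space \<mu>1 = space X" "space \<mu>2 = space X" "space \<nu>1 = space X" "space \<nu>2 = space X"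
    using assms(1-4) by (auto dest: sets_eq_imp_space_eq)
  define C where "C = C1 powr (1 / p2') * C2 powr (1 / q2)"
  have C: "ennreal C = ennreal C1 ^\<^sub>e (1 / p2') * ennreal C2 ^\<^sub>e (1 / q2)" "0 \<le> C"
    using assms(25,26) by (simp_all add: C_def ennpow_ennreal_pos ennreal_mult)
  have q: "0 < q1" "0 < q2" "0 < p2"
    using assms by auto
  define k where "k z w = K1 (fst z, fst w) * K2 (snd z, snd w)" for z w
  have k[measurable]: "(\<lambda>(z, w). k z w) \<in> borel_measurable ((\<nu>1 \<Otimes>\<^sub>M \<nu>2) \<Otimes>\<^sub>M (\<mu>1 \<Otimes>\<^sub>M \<mu>2))"
    unfolding k_def by measurable
  have k_nonneg: "0 \<le> k z w" if "z \<in> space (\<nu>1 \<Otimes>\<^sub>M \<nu>2)" "w \<in> space (\<mu>1 \<Otimes>\<^sub>M \<mu>2)" for z w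
    using that assms(11,12) by (auto simp: k_def space_pair_measure space_eq)
  \<comment> \<open>\<open>F f\<close> is the nonnegative majorant of the norm of
    \<open>T f\<close>. Being defined for every \<open>f\<close>, it can be estimated before
    convergence is known.\<close>
  define F where "F f z = (\<integral>\<^sup>+ t. \<integral>\<^sup>+ s. ennreal (k z (s, t)) * ennreal (norm (f (s, t))) \<partial>\<mu>1 \<partial>\<mu>2)"
    for f :: "'a \<times> 'a \<Rightarrow> 'b" and z
  have norm_eq: "mixed_norm (r1, r2) (L1, L2) g = nn_mixed_norm r1 r2 L1 L2 (\<lambda>z. ennreal (norm (g z)))"
    for r1 r2 :: real and L1 L2 :: "'a measure" and g :: "'a \<times> 'a \<Rightarrow> 'b"
    by (simp add: nn_mixed_norm_def)
  have T: "T f z = (LINT t|\<mu>2. LINT s|\<mu>1. k z (s, t) *\<^sub>R f (s, t))" for f z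
    by (cases z) (simp add: T_def k_def)
  have F_bound: "nn_mixed_norm q1 q2 \<nu>1 \<nu>2 (F f) \<le> ennreal C * mixed_norm (1, p2) (\<mu>1, \<mu>2) f"
    if f[measurable]: "f \<in> borel_measurable (\<mu>1 \<Otimes>\<^sub>M \<mu>2)" for f
  proof -
    \<comment> \<open>The kernel is split into its \<gamma>- and \<delta>-powers, with
      \<open>h1\<close> attached to the former to match the first hypothesis.\<close>
    define a where "a z w = ennreal (K1 (fst z, fst w)) ^\<^sub>e \<gamma>1 * ennreal (K2 (snd z, snd w)) ^\<^sub>e \<gamma>2
      * ennreal (h1 w)" for z w
    define b where "b z w = ennreal (K1 (fst z, fst w)) ^\<^sub>e \<delta>1 * ennreal (K2 (snd z, snd w)) ^\<^sub>e \<delta>2"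
      for z w
    show ?thesis
      unfolding norm_eq C(1) F_def
    proof (rule mixed_Schur_test[where a = a and b = b and g = "\<lambda>w. ennreal (h1 w)"
          and h = "\<lambda>z. ennreal (h2 z)"])
      show "(\<lambda>(z, w). a z w) \<in> borel_measurable ((\<nu>1 \<Otimes>\<^sub>M \<nu>2) \<Otimes>\<^sub>M (\<mu>1 \<Otimes>\<^sub>M \<mu>2))"
        unfolding a_def by measurable
      show "(\<lambda>(z, w). b z w) \<in> borel_measurable ((\<nu>1 \<Otimes>\<^sub>M \<nu>2) \<Otimes>\<^sub>M (\<mu>1 \<Otimes>\<^sub>M \<mu>2))"
        unfolding b_def by measurable
      show "0 < ennreal (h1 w) \<and> ennreal (h1 w) < \<top>" if "w \<in> space (\<mu>1 \<Otimes>\<^sub>M \<mu>2)" for w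
        using that assms(23) by (auto simp: space_pair_measure space_eq)
      show "ennreal (k z w) * ennreal (h1 w) \<le> a z w * b z w"
        if "z \<in> space (\<nu>1 \<Otimes>\<^sub>M \<nu>2)" "w \<in> space (\<mu>1 \<Otimes>\<^sub>M \<mu>2)" for z w
      proof -
        have K: "0 \<le> K1 (fst z, fst w)" "0 \<le> K2 (snd z, snd w)"
          using that assms(11,12) by (auto simp: space_pair_measure space_eq)
        have "ennreal (k z w) * ennreal (h1 w)
            = (ennreal (K1 (fst z, fst w)) * ennreal (K2 (snd z, snd w))) * ennreal (h1 w)"
          using K by (simp add: k_def ennreal_mult)
        also have "\<dots> \<le> ((ennreal (K1 (fst z, fst w)) ^\<^sub>e \<gamma>1 * ennreal (K1 (fst z, fst w)) ^\<^sub>e \<delta>1)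
            * (ennreal (K2 (snd z, snd w)) ^\<^sub>e \<gamma>2 * ennreal (K2 (snd z, snd w)) ^\<^sub>e \<delta>2)) * ennreal (h1 w)"
          using K assms(19,20) by (intro mult_mono ennpow_mult_ennpow_le) auto
        finally show ?thesis
          by (simp add: a_def b_def mult_ac)
      qed
      show "AE z in \<nu>1 \<Otimes>\<^sub>M \<nu>2. (\<integral>\<^sup>+ t. esssup \<mu>1 (\<lambda>s. a z (s, t)) ^\<^sub>e p2' \<partial>\<mu>2)
          \<le> ennreal C1 * ennreal (h2 z) ^\<^sub>e p2'"
        using assms(27) by (simp add: a_def split_beta')
      show "AE w in \<mu>1 \<Otimes>\<^sub>M \<mu>2.
          (\<integral>\<^sup>+ y. (\<integral>\<^sup>+ x. (b (x, y) w * ennreal (h2 (x, y))) ^\<^sub>e q1 \<partial>\<nu>1) ^\<^sub>e (q2 / q1) \<partial>\<nu>2)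
          \<le> ennreal C2 * ennreal (h1 w) ^\<^sub>e q2"
        using assms(28) q by (simp add: b_def split_beta' ennpow_mult ennpow_ennpow)
    qed (use assms in auto)
  qed
  have T_le: "ennreal (norm (T f z)) \<le> F f z"
    if f[measurable]: "f \<in> borel_measurable (\<mu>1 \<Otimes>\<^sub>M \<mu>2)" and z: "z \<in> space (\<nu>1 \<Otimes>\<^sub>M \<nu>2)" for f z
  proof -
    \<comment> \<open>The norm is moved inside one integral at a time, so no joint integrability has
      to be known here.\<close>
    have "ennreal (norm (T f z)) \<le> (\<integral>\<^sup>+ t. norm (LINT s|\<mu>1. k z (s, t) *\<^sub>R f (s, t)) \<partial>\<mu>2)"
      unfolding T by (rule norm_lebesgue_integral_le_nn_integral)
    also have "\<dots> \<le> (\<integral>\<^sup>+ t. \<integral>\<^sup>+ s. norm (k z (s, t) *\<^sub>R f (s, t)) \<partial>\<mu>1 \<partial>\<mu>2)"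
      by (intro nn_integral_mono norm_lebesgue_integral_le_nn_integral)
    also have "\<dots> = F f z"
      unfolding F_def using k_nonneg[OF z]
      by (intro nn_integral_cong) (simp add: space_pair_measure ennreal_mult)
    finally show ?thesis .
  qed
  have T_meas: "T f \<in> borel_measurable (\<nu>1 \<Otimes>\<^sub>M \<nu>2)"
    if [measurable]: "f \<in> borel_measurable (\<mu>1 \<Otimes>\<^sub>M \<mu>2)" for f
    unfolding T[abs_def] by measurable
  have T_bound: "mixed_norm (q1, q2) (\<nu>1, \<nu>2) (T f) \<le> ennreal C * mixed_norm (1, p2) (\<mu>1, \<mu>2) f"
    if "f \<in> borel_measurable (\<mu>1 \<Otimes>\<^sub>M \<mu>2)" for f
  proof -
    have "AE z in \<nu>1 \<Otimes>\<^sub>M \<nu>2. ennreal (norm (T f z)) \<le> F f z"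
      using AE_space by eventually_elim (rule T_le[OF that])
    then have "mixed_norm (q1, q2) (\<nu>1, \<nu>2) (T f) \<le> nn_mixed_norm q1 q2 \<nu>1 \<nu>2 (F f)"
      unfolding norm_eq using assms(7,8) q by (intro nn_mixed_norm_mono_AE)
    with F_bound[OF that] show ?thesis
      by (rule order_trans[rotated])
  qed
  have integrable: "AE z in \<nu>1 \<Otimes>\<^sub>M \<nu>2. integrable (\<mu>1 \<Otimes>\<^sub>M \<mu>2) (\<lambda>w. k z w *\<^sub>R f w)"
    if "f \<in> mixed_Lp (1, p2) (\<mu>1, \<mu>2)" for f :: "'a \<times> 'a \<Rightarrow> 'b"
  proof -
    have f[measurable]: "f \<in> borel_measurable (\<mu>1 \<Otimes>\<^sub>M \<mu>2)" and "mixed_norm (1, p2) (\<mu>1, \<mu>2) f < \<top>"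
      using that by auto
    \<comment> \<open>The estimate for \<open>F f\<close> makes its mixed norm finite, hence
      \<open>F f z\<close> finite for almost every \<open>z\<close>; by Tonelli this number is the
      integral of the norm over the product.\<close>
    then have fin: "nn_mixed_norm q1 q2 \<nu>1 \<nu>2 (F f) < \<top>"
      by (intro le_less_trans[OF F_bound]) (auto simp: ennreal_mult_less_top)
    have F[measurable]: "F f \<in> borel_measurable (\<nu>1 \<Otimes>\<^sub>M \<nu>2)"
      unfolding F_def[abs_def] by measurable
    have "AE z in \<nu>1 \<Otimes>\<^sub>M \<nu>2. F f z < \<top>"
      using assms(7,8) q(1,2) F fin by (rule nn_mixed_norm_finite_AE)
    then show ?thesis
      using AE_space
    proof eventually_elim
      case (elim z)
      note z[measurable] = elim(2)
      have "(\<integral>\<^sup>+ w. ennreal (norm (k z w *\<^sub>R f w)) \<partial>(\<mu>1 \<Otimes>\<^sub>M \<mu>2))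
          = (\<integral>\<^sup>+ t. \<integral>\<^sup>+ s. ennreal (norm (k z (s, t) *\<^sub>R f (s, t))) \<partial>\<mu>1 \<partial>\<mu>2)"
        by (intro M.nn_integral_snd[symmetric]) measurable
      also have "\<dots> = F f z"
        unfolding F_def using k_nonneg[OF z]
        by (intro nn_integral_cong) (simp add: space_pair_measure ennreal_mult)
      finally show ?case
        using elim(1) by (intro integrableI_bounded) auto
    qed
  qed
  \<comment> \<open>Fubini's theorem rewrites the iterated integral as one over the product measure.
    There null sets of the product can be ignored and linearity applies directly, which gives
    \<open>cong\<close> and \<open>lin\<close>.\<close>
  have T_eq: "T f z = (LINT w|(\<mu>1 \<Otimes>\<^sub>M \<mu>2). k z w *\<^sub>R f w)"
    if "integrable (\<mu>1 \<Otimes>\<^sub>M \<mu>2) (\<lambda>w. k z w *\<^sub>R f w)" for f z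
    using that M.integral_snd[of "\<lambda>s t. k z (s, t) *\<^sub>R f (s, t)"] by (simp add: T split_beta')
  have cong: "AE z in \<nu>1 \<Otimes>\<^sub>M \<nu>2. T f z = T g z"
    if f: "f \<in> mixed_Lp (1, p2) (\<mu>1, \<mu>2)" and g: "g \<in> mixed_Lp (1, p2) (\<mu>1, \<mu>2)"
      and "AE w in \<mu>1 \<Otimes>\<^sub>M \<mu>2. f w = g w" for f g
    using integrable[OF f] integrable[OF g]
  proof eventually_elim
    case (elim z)
    then show ?case
      using that(3) by (auto simp: T_eq intro!: integral_cong_AE dest: borel_measurable_integrable)
  qed
  have lin: "AE z in \<nu>1 \<Otimes>\<^sub>M \<nu>2. T (\<lambda>w. a * f w + b * g w) z = a * T f z + b * T g z"
    if f: "f \<in> mixed_Lp (1, p2) (\<mu>1, \<mu>2)" and g: "g \<in> mixed_Lp (1, p2) (\<mu>1, \<mu>2)" for f g a b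
    using integrable[OF f] integrable[OF g]
  proof eventually_elim
    case (elim z)
    have eq: "k z w *\<^sub>R (a * f w + b * g w) = a * (k z w *\<^sub>R f w) + b * (k z w *\<^sub>R g w)" for w
      by (simp add: scaleR_add_right)
    have "integrable (\<mu>1 \<Otimes>\<^sub>M \<mu>2) (\<lambda>w. k z w *\<^sub>R (a * f w + b * g w))"
      unfolding eq using elim by (intro Bochner_Integration.integrable_add integrable_mult_right)
    then have "T (\<lambda>w. a * f w + b * g w) z
        = (LINT w|(\<mu>1 \<Otimes>\<^sub>M \<mu>2). a * (k z w *\<^sub>R f w) + b * (k z w *\<^sub>R g w))"
      by (simp only: T_eq eq)
    also have "\<dots> = a * T f z + b * T g z"
      using elim by (simp add: T_eq del: mult_scaleR_right)
    finally show ?case .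
  qed
  have "mixed_bounded_operator (1, p2) (\<mu>1, \<mu>2) (q1, q2) (\<nu>1, \<nu>2) T"
    unfolding mixed_bounded_operator.simps
  proof (intro conjI ballI allI impI)
    fix f :: "'a \<times> 'a \<Rightarrow> 'b" assume f: "f \<in> mixed_Lp (1, p2) (\<mu>1, \<mu>2)"
    then have "ennreal C * mixed_norm (1, p2) (\<mu>1, \<mu>2) f < \<top>"
      by (auto simp: ennreal_mult_less_top)
    with T_bound[of f] T_meas[of f] f show "T f \<in> mixed_Lp (q1, q2) (\<nu>1, \<nu>2)"
      by (auto simp del: mixed_norm.simps)
  next
    show "\<exists>C\<ge>0. \<forall>f\<in>mixed_Lp (1, p2) (\<mu>1, \<mu>2).
        mixed_norm (q1, q2) (\<nu>1, \<nu>2) (T f) \<le> ennreal C * mixed_norm (1, p2) (\<mu>1, \<mu>2) f"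
      using C(2) T_bound by (auto simp del: mixed_norm.simps)
  qed (fact cong lin)+
  moreover have "mixed_op_norm (1, p2) (\<mu>1, \<mu>2) (q1, q2) (\<nu>1, \<nu>2) T \<le> ennreal C"
    unfolding mixed_op_norm_def
  proof (rule SUP_least)
    fix f :: "'a \<times> 'a \<Rightarrow> 'b"
    assume "f \<in> {f \<in> mixed_Lp (1, p2) (\<mu>1, \<mu>2). mixed_norm (1, p2) (\<mu>1, \<mu>2) f \<le> 1}"
    then have "f \<in> borel_measurable (\<mu>1 \<Otimes>\<^sub>M \<mu>2)" "mixed_norm (1, p2) (\<mu>1, \<mu>2) f \<le> 1"
      by (auto simp del: mixed_norm.simps)
    then show "mixed_norm (q1, q2) (\<nu>1, \<nu>2) (T f) \<le> ennreal C"
      using order_trans[OF T_bound mult_left_mono[of _ 1]] by (simp del: mixed_norm.simps)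
  qed
  ultimately show ?thesis
    using integrable by (simp add: C_def k_def split_beta' del: mixed_Lp.simps)
qed

end
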